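(* Let $G$ be an abelian group, and let $A,B\subseteq G$ be finite and nonempty with $|A|\geq 2$ and $|B|\geq 2$. Then either $$|A+_1B|+|A+_2B|\geq 2|A|+2|B|-4,$$ or else there exist $A'\subseteq A$ and $B'\subseteq B$ such that, writing $l:=|A\setminus A'|+|B\setminus B'|$, letting $H$ be the stabilizer of $A+_2B$, and writing $\rho:=|A'+H|-|A'|+|B'+H|-|B'|$, the subgroup $H$ is nontrivial and $$l\leq 1,$$ $$A'+_2B'=A'+B'=A+_2B,$$ $$|A+_1B|+|A+_2B|\geq 2|A|+2|B|-(2-l)(|H|-\rho)-2l\geq 2|A|+2|B|-2|H|.$$
   Context: $G$ is written additively. For finite subsets $A,B\subseteq G$: $A+B=\{a+b\mid a\in A,\ b\in B\}$. For $g\in G$, $r_{A,B}(g)=|(g-B)\cap A|$ is the number of representations $g=a+b$ with $a\in A$, $b\in B$. For an integer $i\geq 1$, $A+_iB:=\{g\in G\mid r_{A,B}(g)\geq i\}$ (so $A+_1B=A+B$). The stabilizer of a set $X\subseteq G$ is the subgroup $H(X)=\{x\in G\mid x+X=X\}$. *)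

theory Defs
  imports "HOL-Library.Set_Algebras"
begin

text \<open>
  The ambient abelian group G is a type of class \<^class>\<open>ab_group_add\<close>. Sumsets of sets are
  written with the pointwise sum on sets from Set_Algebras, while \<open>A - B\<close> on sets is still set
  difference; the set \<open>g - B\<close> of the paper is therefore written as an image.
\<close>

definition rep_count :: "'a::ab_group_add set \<Rightarrow> 'a set \<Rightarrow> 'a \<Rightarrow> nat" where
  "rep_count A B g = card ((\<lambda>b. g - b) ` B \<inter> A)"

definition popular_sumset :: "'a::ab_group_add set \<Rightarrow> nat \<Rightarrow> 'a set \<Rightarrow> 'a set" where
  "popular_sumset A i B = {g. rep_count A B g \<ge> i}"

text \<open>The stabilizer of the empty set is the whole group.\<close>

definition stabilizer :: "'a::ab_group_add set \<Rightarrow> 'a set" where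
  "stabilizer X = {x. x +o X = X}"

lemma popular_sumset_1:
  fixes A B :: "'a::ab_group_add set"
  assumes "finite A"
  shows "popular_sumset A 1 B = A + B"
proof -
  have "rep_count A B g \<ge> 1 \<longleftrightarrow> g \<in> A + B" for g
  proof -
    have "rep_count A B g \<ge> 1 \<longleftrightarrow> (\<lambda>b. g - b) ` B \<inter> A \<noteq> {}"
      using assms by (simp add: rep_count_def Suc_le_eq card_gt_0_iff)
    also have "\<dots> \<longleftrightarrow> (\<exists>a\<in>A. \<exists>b\<in>B. g = a + b)"
    proof
      assume "(\<lambda>b. g - b) ` B \<inter> A \<noteq> {}"
      then obtain b where "b \<in> B" "g - b \<in> A"
        by blast
      moreover have "g = (g - b) + b"
        by simp
      ultimately show "\<exists>a\<in>A. \<exists>b\<in>B. g = a + b"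
        by blast
    next
      assume "\<exists>a\<in>A. \<exists>b\<in>B. g = a + b"
      then obtain a b where ab: "a \<in> A" "b \<in> B" "g = a + b"
        by blast
      then have "a = g - b"
        by simp
      then have "a \<in> (\<lambda>b. g - b) ` B"
        using ab(2) by (rule image_eqI)
      then show "(\<lambda>b. g - b) ` B \<inter> A \<noteq> {}"
        using ab(1) by blast
    qed
    finally show ?thesis
      by (simp add: set_plus_def)
  qed
  then show ?thesis
    by (auto simp: popular_sumset_def)
qed

lemma stabilizer_subgroup:
  fixes X :: "'a::ab_group_add set"
  shows "0 \<in> stabilizer X"
    and "x \<in> stabilizer X \<Longrightarrow> y \<in> stabilizer X \<Longrightarrow> x + y \<in> stabilizer X"
    and "x \<in> stabilizer X \<Longrightarrow> - x \<in> stabilizer X"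
proof -
  show "0 \<in> stabilizer X"
    by (simp add: stabilizer_def)
  show "x + y \<in> stabilizer X" if "x \<in> stabilizer X" "y \<in> stabilizer X"
    using that set_plus_rearrange2[of x y X] by (simp add: stabilizer_def)
  show "- x \<in> stabilizer X" if "x \<in> stabilizer X"
  proof -
    have "- x +o (x +o X) = X"
      by (simp add: set_plus_rearrange2)
    with that show ?thesis
      by (simp add: stabilizer_def)
  qed
qed

end

theory Submission
  imports Defs
begin

text \<open>
  Suppose first that two sums \<open>a1 + b1\<close> and \<open>a2 + b2\<close> with \<open>a1 \<noteq> a2\<close> and \<open>b1 \<noteq> b2\<close> have a unique
  representation. Then the first alternative holds, by induction on \<open>|A| + |B|\<close> and \<open>|B|\<close>: if
  \<open>a1 + b2\<close> has at least three representations, one of them is \<open>a' + b'\<close> with \<open>b' \<noteq> b1, b2\<close>, and the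
  Dyson transform by \<open>a1 - b'\<close> removes \<open>b1\<close> from \<open>B\<close> while keeping two such unique sums; otherwise
  deleting \<open>a1\<close> decreases \<open>|A +\<^sub>1 B| + |A +\<^sub>2 B|\<close> by at least 2. If the deletion destroys the
  hypothesis, two deletions together cover all unique sums, and the Kemperman-Scherk bound applies to
  both.

  In the remaining case the unique sums all involve one common summand. Deleting it (\<open>l = 1\<close>, or
  \<open>l = 0\<close> if every sum has two representations) leaves sets whose sumset is \<open>A +\<^sub>2 B\<close>, and the
  bounds follow from Kneser's theorem. Kneser's theorem is obtained by covering \<open>A + B\<close> with sets \<open>C\<close>
  satisfying \<open>|C| + |H(C)| \<ge> |A| + |B|\<close>, an inequality that is preserved by unions.
\<close>

subsection \<open>Unique sums and the Dyson transform\<close>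

definition dyson_union :: "'a::ab_group_add \<Rightarrow> 'a set \<Rightarrow> 'a set \<Rightarrow> 'a set" where
  "dyson_union e A B = A \<union> (+) e ` B"

text \<open>The intersection of \<open>A\<close> with the translate of \<open>B\<close> by
  \<open>e\<close>, moved back by \<open>- e\<close>. In this normalization the second set stays
  inside \<open>B\<close> and its sums with \<open>dyson_union e A B\<close> stay inside
  \<open>A + B\<close>.\<close>

definition dyson_inter :: "'a::ab_group_add \<Rightarrow> 'a set \<Rightarrow> 'a set \<Rightarrow> 'a set" where
  "dyson_inter e A B = {b \<in> B. e + b \<in> A}"

text \<open>Records the two summands rather than the sum, because the case distinctions below
  compare summands of different unique sums.\<close>

definition unique_pair :: "'a::ab_group_add set \<Rightarrow> 'a set \<Rightarrow> 'a \<Rightarrow> 'a \<Rightarrow> bool" where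
  "unique_pair A B a b \<longleftrightarrow> a \<in> A \<and> b \<in> B \<and>
     (\<forall>a'\<in>A. \<forall>b'\<in>B. a' + b' = a + b \<longrightarrow> a' = a \<and> b' = b)"

section \<open>Representation counts and popular sums\<close>

lemma rep_count_eq: "rep_count A B g = card {b \<in> B. g - b \<in> A}"
proof -
  have "(\<lambda>b. g - b) ` B \<inter> A = (\<lambda>b. g - b) ` {b \<in> B. g - b \<in> A}" by auto
  moreover have "inj_on (\<lambda>b. g - b) {b \<in> B. g - b \<in> A}" by (auto simp: inj_on_def)
  ultimately show ?thesis by (simp add: rep_count_def card_image)
qed

lemma rep_count_commute: "rep_count A B g = rep_count B A g"
proof -
  have "bij_betw (\<lambda>b. g - b) {b \<in> B. g - b \<in> A} {a \<in> A. g - a \<in> B}"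
    by (rule bij_betw_byWitness[where f' = "\<lambda>a. g - a"]) auto
  then show ?thesis by (simp add: rep_count_eq bij_betw_same_card)
qed

lemma popular_sumset_commute: "popular_sumset A i B = popular_sumset B i A"
  by (simp add: popular_sumset_def rep_count_commute)

lemma unique_pair_commute: "unique_pair A B a b \<longleftrightarrow> unique_pair B A b a"
  by (auto simp: unique_pair_def add.commute)

lemma popular_sumset_2_iff:
  assumes "finite B"
  shows "g \<in> popular_sumset A 2 B \<longleftrightarrow>
    (\<exists>a\<in>A. \<exists>b\<in>B. \<exists>a'\<in>A. \<exists>b'\<in>B. g = a + b \<and> g = a' + b' \<and> b \<noteq> b')"
proof
  assume "g \<in> popular_sumset A 2 B"
  then have "\<not> card {b \<in> B. g - b \<in> A} \<le> Suc 0"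
    by (simp add: popular_sumset_def rep_count_eq)
  then obtain b b' where "b \<in> B" "g - b \<in> A" "b' \<in> B" "g - b' \<in> A" "b \<noteq> b'"
    using assms by (auto simp: card_le_Suc0_iff_eq)
  then show "\<exists>a\<in>A. \<exists>b\<in>B. \<exists>a'\<in>A. \<exists>b'\<in>B. g = a + b \<and> g = a' + b' \<and> b \<noteq> b'"
    by (metis diff_add_cancel)
next
  assume "\<exists>a\<in>A. \<exists>b\<in>B. \<exists>a'\<in>A. \<exists>b'\<in>B. g = a + b \<and> g = a' + b' \<and> b \<noteq> b'"
  then obtain a b a' b' where *: "a \<in> A" "b \<in> B" "a' \<in> A" "b' \<in> B"
    "g = a + b" "g = a' + b'" "b \<noteq> b'" by blast
  have "g - b = a" "g - b' = a'" using * by (metis add_diff_cancel)+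
  then have "{b, b'} \<subseteq> {b \<in> B. g - b \<in> A}" using * by auto
  then have "card {b, b'} \<le> card {b \<in> B. g - b \<in> A}" using assms by (intro card_mono) auto
  then show "g \<in> popular_sumset A 2 B" using * by (simp add: popular_sumset_def rep_count_eq)
qed

lemma popular_sumset_2_subset: "finite B \<Longrightarrow> popular_sumset A 2 B \<subseteq> A + B"
  by (auto simp: popular_sumset_2_iff)

lemma not_popular_iff_unique_pair:
  assumes "finite B" "a \<in> A" "b \<in> B"
  shows "a + b \<notin> popular_sumset A 2 B \<longleftrightarrow> unique_pair A B a b"
  unfolding popular_sumset_2_iff[OF assms(1)] unique_pair_def
  using assms(2,3) by (metis add_right_imp_eq)

section \<open>Effect of the Dyson transform on sizes, sums and unique pairs\<close>

lemma finite_dyson: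
  assumes "finite A" "finite B"
  shows "finite (dyson_union e A B)" "finite (dyson_inter e A B)"
  using assms by (auto simp: dyson_union_def dyson_inter_def)

lemma card_dyson:
  assumes "finite A" "finite B"
  shows "card (dyson_union e A B) + card (dyson_inter e A B) = card A + card B"
proof -
  have "A \<inter> (+) e ` B = (+) e ` dyson_inter e A B"
    by (auto simp: dyson_inter_def)
  then have "card (A \<inter> (+) e ` B) = card (dyson_inter e A B)"
    by (simp add: card_image)
  moreover have "card ((+) e ` B) = card B" by (simp add: card_image)
  ultimately show ?thesis
    using card_Un_Int[of A "(+) e ` B"] assms by (simp add: dyson_union_def)
qed

lemma dyson_sumset_subset: "dyson_union e A B + dyson_inter e A B \<subseteq> A + B"
proof
  fix x assume "x \<in> dyson_union e A B + dyson_inter e A B"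
  then obtain u i where x: "x = u + i" "u \<in> dyson_union e A B" "i \<in> B" "e + i \<in> A"
    by (auto simp: set_plus_def dyson_inter_def)
  from x(2) consider "u \<in> A" | b where "b \<in> B" "u = e + b" by (auto simp: dyson_union_def)
  then show "x \<in> A + B"
  proof cases
    case 1
    with x show ?thesis by auto
  next
    case 2
    \<comment> \<open>The shift \<open>e\<close> passes from \<open>b\<close> to \<open>i\<close>,
      whose translate \<open>e + i\<close> lies in \<open>A\<close>.\<close>
    have "(e + i) + b \<in> A + B" using x 2 by (intro set_plus_intro)
    moreover have "x = (e + i) + b" using x 2 by (simp add: algebra_simps)
    ultimately show ?thesis by simp
  qed
qed

text \<open>A representation \<open>g = u + b\<close> of the transformed pair is kept if
  \<open>u \<in> A\<close>. Otherwise \<open>u = e + c\<close> with \<open>c \<in> B\<close>, and it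
  is replaced by \<open>g = (e + b) + c\<close>. No collision occurs: a kept \<open>b\<close> and a
  replaced \<open>c\<close> with the same image would satisfy \<open>g - c = e + b \<in> A\<close>,
  so \<open>c\<close> would have been kept.\<close>

lemma rep_count_dyson_le:
  assumes "finite B"
  shows "rep_count (dyson_union e A B) (dyson_inter e A B) g \<le> rep_count A B g"
proof -
  define f where "f b = (if g - b \<in> A then b else g - b - e)" for b
  let ?S = "{b \<in> dyson_inter e A B. g - b \<in> dyson_union e A B}"
  have "inj_on f ?S"
  proof (rule inj_onI)
    fix b c assume b: "b \<in> ?S" and c: "c \<in> ?S" and eq: "f b = f c"
    have bA: "e + b \<in> A" "e + c \<in> A" using b c by (auto simp: dyson_inter_def)
    show "b = c"
    proof (cases "g - b \<in> A \<longleftrightarrow> g - c \<in> A")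
      case True
      then show ?thesis using eq by (simp add: f_def split: if_splits)
    next
      case False
      then have "b = g - c - e \<and> g - c \<notin> A \<or> c = g - b - e \<and> g - b \<notin> A"
        using eq by (simp add: f_def split: if_splits)
      then have "e + b = g - c \<and> g - c \<notin> A \<or> e + c = g - b \<and> g - b \<notin> A"
        by (auto simp: algebra_simps)
      then show ?thesis using bA by auto
    qed
  qed
  moreover have "f ` ?S \<subseteq> {b \<in> B. g - b \<in> A}"
  proof
    fix y assume "y \<in> f ` ?S"
    then obtain b where b: "b \<in> ?S" "y = f b" by blast
    show "y \<in> {b \<in> B. g - b \<in> A}"
    proof (cases "g - b \<in> A")
      case True
      then show ?thesis using b by (simp add: f_def dyson_inter_def)
    next
      case False
      then obtain c where c: "c \<in> B" "g - b = e + c" using b by (auto simp: dyson_union_def)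
      then have "y = c" using b False by (simp add: f_def)
      moreover have "g - c = e + b" using c(2) by (simp add: algebra_simps)
      ultimately show ?thesis using b c by (simp add: dyson_inter_def)
    qed
  qed
  ultimately have "card ?S \<le> card {b \<in> B. g - b \<in> A}"
    using assms by (intro card_inj_on_le[where f = f]) auto
  then show ?thesis by (simp add: rep_count_eq)
qed

lemma popular_sumset_dyson_subset:
  assumes "finite B"
  shows "popular_sumset (dyson_union e A B) i (dyson_inter e A B) \<subseteq> popular_sumset A i B"
  using rep_count_dyson_le[OF assms, of e A] by (auto simp: popular_sumset_def intro: order_trans)

text \<open>Although \<open>b\<close> is lost, \<open>a + b\<close> survives the transform through another representation.\<close>

lemma unique_pair_dyson_shift:
  assumes u: "unique_pair A B a b" and b': "b' \<in> B" "b' \<noteq> b" and e: "e = a - b'"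
  shows "e + b \<notin> A" "b \<notin> dyson_inter e A B" "b' \<in> dyson_inter e A B"
    "unique_pair (dyson_union e A B) (dyson_inter e A B) (e + b) b'"
proof -
  have aA: "a \<in> A" and bB: "b \<in> B"
    and uq: "\<And>x y. x \<in> A \<Longrightarrow> y \<in> B \<Longrightarrow> x + y = a + b \<Longrightarrow> x = a \<and> y = b"
    using u by (auto simp: unique_pair_def)
  have eb: "e + b + b' = a + b" by (simp add: e algebra_simps)
  show n: "e + b \<notin> A" using uq[OF _ b'(1) eb] b' by blast
  then show nI: "b \<notin> dyson_inter e A B" by (simp add: dyson_inter_def)
  show b'I: "b' \<in> dyson_inter e A B" using b' aA by (simp add: dyson_inter_def e)
  show "unique_pair (dyson_union e A B) (dyson_inter e A B) (e + b) b'"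
    unfolding unique_pair_def
  proof (intro conjI ballI impI)
    show "e + b \<in> dyson_union e A B" using bB by (auto simp: dyson_union_def)
    show "b' \<in> dyson_inter e A B" by fact
    fix x i assume x: "x \<in> dyson_union e A B" and i: "i \<in> dyson_inter e A B"
      and s: "x + i = e + b + b'"
    from i have iB: "i \<in> B" "e + i \<in> A" by (auto simp: dyson_inter_def)
    from x consider "x \<in> A" | y where "y \<in> B" "x = e + y" by (auto simp: dyson_union_def)
    then have "i = b'"
    proof cases
      case 1
      then have "i = b" using uq iB s eb by simp
      then show ?thesis using nI i by simp
    next
      case 2
      then have "e + i + y = a + b" using s eb by (simp add: algebra_simps)
      then have "e + i = a" using uq iB 2 by blast
      then show ?thesis using e by (simp add: algebra_simps)
    qed
    then show "x = e + b" "i = b'" using s by auto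
  qed
qed

text \<open>A representation \<open>(e + y) + i\<close> of \<open>a + b\<close> flips to
  \<open>(e + i) + y\<close> in \<open>A + B\<close>, which forces \<open>y = b\<close>. Since
  \<open>b\<close> survives, \<open>e + b\<close> lies in \<open>A\<close> anyway, so the original
  representation was already one of \<open>A + B\<close>.\<close>

lemma unique_pair_dyson:
  assumes u: "unique_pair A B a b" and b: "b \<in> dyson_inter e A B"
  shows "unique_pair (dyson_union e A B) (dyson_inter e A B) a b"
  unfolding unique_pair_def
proof (intro conjI ballI impI)
  have uq: "\<And>x y. x \<in> A \<Longrightarrow> y \<in> B \<Longrightarrow> x + y = a + b \<Longrightarrow> x = a \<and> y = b" and aA: "a \<in> A"
    using u by (auto simp: unique_pair_def)
  show "a \<in> dyson_union e A B" using aA by (simp add: dyson_union_def)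
  show "b \<in> dyson_inter e A B" by fact
  fix x i assume x: "x \<in> dyson_union e A B" and i: "i \<in> dyson_inter e A B" and s: "x + i = a + b"
  from i have iB: "i \<in> B" "e + i \<in> A" by (auto simp: dyson_inter_def)
  from x consider "x \<in> A" | y where "y \<in> B" "x = e + y" by (auto simp: dyson_union_def)
  then have "i = b"
  proof cases
    case 1
    then show ?thesis using uq iB s by blast
  next
    case 2
    then have "e + i + y = a + b" using s by (simp add: algebra_simps)
    then have "y = b" using uq iB 2 by blast
    then have "x \<in> A" using 2 b by (auto simp: dyson_inter_def)
    then show ?thesis using uq iB s by blast
  qed
  then show "x = a" "i = b" using s by auto
qed

lemma unique_pair_mono:
  "unique_pair A B a b \<Longrightarrow> A' \<subseteq> A \<Longrightarrow> B' \<subseteq> B \<Longrightarrow> a \<in> A' \<Longrightarrow> b \<in> B' \<Longrightarrow> unique_pair A' B' a b"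
  unfolding unique_pair_def by blast

text \<open>The transform by \<open>a - b'\<close> keeps \<open>card A + card B\<close>, does not
  enlarge the sumset, drops \<open>b\<close> from the second set and still leaves a unique pair.
  Repeating it reduces the second set to a single element.\<close>

theorem kemperman_scherk:
  assumes "finite A" "finite B" "unique_pair A B a b"
  shows "card A + card B \<le> card (A + B) + 1"
  using assms
proof (induction "card B" arbitrary: A B a b rule: less_induct)
  case less
  then have ab: "a \<in> A" "b \<in> B" by (auto simp: unique_pair_def)
  show ?case
  proof (cases "B = {b}")
    case True
    have "A + B = (\<lambda>x. x + b) ` A" by (auto simp: True set_plus_def)
    then show ?thesis by (simp add: True card_image)
  next
    case False
    then obtain b' where b': "b' \<in> B" "b' \<noteq> b" using ab by auto
    define e where "e = a - b'"
    note s = unique_pair_dyson_shift[OF less.prems(3) b' e_def]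
    have "dyson_inter e A B \<subset> B" using s(2) ab by (auto simp: dyson_inter_def)
    then have "card (dyson_inter e A B) < card B" by (simp add: less.prems psubset_card_mono)
    then have "card (dyson_union e A B) + card (dyson_inter e A B)
        \<le> card (dyson_union e A B + dyson_inter e A B) + 1"
      using less.hyps s(4) finite_dyson[OF less.prems(1,2)] by blast
    moreover have "card (dyson_union e A B + dyson_inter e A B) \<le> card (A + B)"
      using less.prems by (intro card_mono dyson_sumset_subset finite_set_plus)
    ultimately show ?thesis using card_dyson[OF less.prems(1,2), of e] by simp
  qed
qed

subsection \<open>Two disjoint unique sums\<close>

text \<open>The induction is lexicographic because the Dyson transform preserves
  \<open>card A + card B\<close> and only shrinks the second set, while deleting an element shrinks
  the sum.\<close>

lemma sum_popular_lower_bound: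
  assumes "finite A" "finite B"
    and "unique_pair A B a1 b1" "unique_pair A B a2 b2" "a1 \<noteq> a2" "b1 \<noteq> b2"
  shows "2 * card A + 2 * card B \<le> card (A + B) + card (popular_sumset A 2 B) + 4"
  using assms
proof (induction "(card A + card B, card B)" arbitrary: A B a1 b1 a2 b2
    rule: wf_induct_rule[OF wf_lex_prod[OF wf_less_than wf_less_than]])
  case 1
  note fin = 1(2,3) and u1 = 1(4) and u2 = 1(5) and neq = 1(6,7)
  have IH: "2 * card A' + 2 * card B' \<le> card (A' + B') + card (popular_sumset A' 2 B') + 4"
    if "card A' + card B' < card A + card B \<or>
        card A' + card B' = card A + card B \<and> card B' < card B"
      "finite A'" "finite B'" "unique_pair A' B' x y" "unique_pair A' B' x' y'" "x \<noteq> x'" "y \<noteq> y'"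
    for A' B' :: "'a set" and x y x' y'
    using 1(1)[OF _ that(2-7)] that(1) by auto
  have ab: "a1 \<in> A" "b1 \<in> B" "a2 \<in> A" "b2 \<in> B" using u1 u2 by (auto simp: unique_pair_def)
  have finS: "finite (A + B)" using fin by (rule finite_set_plus)
  have N21: "popular_sumset A 2 B \<subseteq> A + B" using fin by (intro popular_sumset_2_subset)
  then have finP: "finite (popular_sumset A 2 B)" using finS finite_subset by blast
  \<comment> \<open>If no such representation exists, the second summand in any representation of
    \<open>a1 + b2\<close> is \<open>b2\<close> or \<open>b1\<close>, so there are at most two of
    them.\<close>
  show ?case
  proof (cases "\<exists>a'\<in>A. \<exists>b'\<in>B. a1 + b2 = a' + b' \<and> b' \<noteq> b1 \<and> b' \<noteq> b2")
    case True
    then obtain a' b' where *: "a' \<in> A" "b' \<in> B" "a1 + b2 = a' + b'" "b' \<noteq> b1" "b' \<noteq> b2"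
      by blast
    \<comment> \<open>This shift replaces the pair \<open>(a1, b1)\<close> by
      \<open>(e + b1, b')\<close> and keeps \<open>(a2, b2)\<close>, because
      \<open>e + b2 = a'\<close> lies in \<open>A\<close>. The two pairs remain disjoint:
      \<open>e + b1 \<notin> A\<close> while \<open>a2 \<in> A\<close>, and
      \<open>b' \<noteq> b2\<close>.\<close>
    define e where "e = a1 - b'"
    let ?U = "dyson_union e A B" and ?I = "dyson_inter e A B"
    note s = unique_pair_dyson_shift[OF u1 *(2,4) e_def]
    have "e + b2 = a'" using *(3) by (simp add: e_def algebra_simps)
    then have "b2 \<in> ?I" using * ab by (simp add: dyson_inter_def)
    then have s2: "unique_pair ?U ?I a2 b2" by (rule unique_pair_dyson[OF u2])
    have "?I \<subset> B" using s(2) ab by (auto simp: dyson_inter_def)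
    then have "card ?I < card B" by (simp add: fin psubset_card_mono)
    moreover have c: "card ?U + card ?I = card A + card B" using fin by (rule card_dyson)
    moreover have "e + b1 \<noteq> a2" using s(1) ab by blast
    ultimately have "2 * card ?U + 2 * card ?I \<le> card (?U + ?I) + card (popular_sumset ?U 2 ?I) + 4"
      using IH[OF _ finite_dyson[OF fin] s(4) s2] * by blast
    moreover have "card (?U + ?I) \<le> card (A + B)"
      by (intro card_mono dyson_sumset_subset finS)
    moreover have "card (popular_sumset ?U 2 ?I) \<le> card (popular_sumset A 2 B)"
      using fin by (intro card_mono popular_sumset_dyson_subset finP)
    ultimately show ?thesis using c by linarith
  next
    case False
    let ?A = "A - {a1}"
    have cA: "card A = card ?A + 1" using fin ab by (metis Suc_eq_plus1 card_Suc_Diff1)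
    have cB: "card B = card (B - {b2}) + 1" using fin ab by (metis Suc_eq_plus1 card_Suc_Diff1)
    have cA2: "card A = card (A - {a2}) + 1" using fin ab by (metis Suc_eq_plus1 card_Suc_Diff1)
    have finA: "finite ?A" using fin by simp
    have u2': "unique_pair ?A B a2 b2"
      using neq ab by (intro unique_pair_mono[OF u2]) auto
    have sub1: "?A + B \<subseteq> A + B" by (intro set_plus_mono2) auto
    have V1: "card A + card B \<le> card (?A + B) + 2"
      using kemperman_scherk[OF finA fin(2) u2'] cA by simp
    \<comment> \<open>In case \<open>deep\<close> the induction hypothesis applies after deleting
      \<open>a1\<close>. In case \<open>star\<close> all unique pairs left share \<open>a2\<close>
      or share \<open>b2\<close>; removing that element instead gives \<open>A2\<close> and
      \<open>B2\<close>, which still contain the unique pair \<open>(a1, b1)\<close>.\<close>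
    consider (deep) a b a' b' where "unique_pair ?A B a b" "unique_pair ?A B a' b'" "a \<noteq> a'" "b \<noteq> b'"
      | (star) A2 B2 where "A2 \<subseteq> A" "B2 \<subseteq> B" "a1 \<in> A2" "b1 \<in> B2" "card A + card B = card A2 + card B2 + 1"
        "\<And>a b. unique_pair ?A B a b \<Longrightarrow> a \<notin> A2 \<or> b \<notin> B2"
    proof (cases "\<exists>a b a' b'. unique_pair ?A B a b \<and> unique_pair ?A B a' b' \<and> a \<noteq> a' \<and> b \<noteq> b'")
      case True
      then show ?thesis using deep by blast
    next
      case nodeep: False
      \<comment> \<open>A unique pair avoiding \<open>a2\<close> meets \<open>(a2, b2)\<close> in
        \<open>b2\<close>, and one avoiding \<open>b2\<close> meets it in \<open>a2\<close>; two
        such pairs would be disjoint.\<close>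
      have "(\<forall>a b. unique_pair ?A B a b \<longrightarrow> a = a2) \<or> (\<forall>a b. unique_pair ?A B a b \<longrightarrow> b = b2)"
      proof (rule ccontr)
        assume "\<not> ?thesis"
        then obtain a b a' b' where *: "unique_pair ?A B a b" "a \<noteq> a2"
          "unique_pair ?A B a' b'" "b' \<noteq> b2" by blast
        have "b = b2" using nodeep * u2' by blast
        moreover have "a' = a2" using nodeep * u2' by blast
        ultimately show False using nodeep * by blast
      qed
      then consider "\<forall>a b. unique_pair ?A B a b \<longrightarrow> a = a2"
        | "\<forall>a b. unique_pair ?A B a b \<longrightarrow> b = b2"
        by blast
      then show ?thesis
      proof cases
        case 1
        show ?thesis by (rule star[of "A - {a2}" B]) (use 1 ab neq cA2 in auto)
      next
        case 2
        show ?thesis by (rule star[of A "B - {b2}"]) (use 2 ab neq cB in auto)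
      qed
    qed
    then show ?thesis
    proof cases
      case deep
      have "2 * card ?A + 2 * card B \<le> card (?A + B) + card (popular_sumset ?A 2 B) + 4"
        using IH[OF _ finA fin(2) deep] cA by simp
      \<comment> \<open>Two losses are exhibited: \<open>a1 + b1\<close> leaves the sumset, and
        \<open>a1 + b2\<close> leaves the popular sums if it was popular, or else, being a unique
        sum, leaves the sumset as well.\<close>
      moreover have "card (?A + B) + card (popular_sumset ?A 2 B) + 2
          \<le> card (A + B) + card (popular_sumset A 2 B)"
      proof -
        have p: "popular_sumset ?A 2 B \<subseteq> popular_sumset A 2 B"
          unfolding popular_sumset_2_iff[OF fin(2)] subset_iff by blast
        have new: "a1 + b \<notin> ?A + B" if "unique_pair A B a1 b" for b
        proof
          assume "a1 + b \<in> ?A + B"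
          then obtain x y where "x \<in> ?A" "y \<in> B" "x + y = a1 + b" by (metis set_plus_elim)
          then show False using that by (auto simp: unique_pair_def)
        qed
        have x1: "a1 + b1 \<in> A + B" "a1 + b1 \<notin> ?A + B"
          using ab new[OF u1] by auto
        have x2: "a1 + b2 \<in> A + B" using ab by auto
        have ne: "a1 + b1 \<noteq> a1 + b2" using neq by simp
        have x3: "a1 + b2 \<notin> popular_sumset ?A 2 B"
        proof
          assume "a1 + b2 \<in> popular_sumset ?A 2 B"
          then obtain a b a' b' where *: "a \<in> ?A" "b \<in> B" "a' \<in> ?A" "b' \<in> B" "a1 + b2 = a + b"
            "a1 + b2 = a' + b'" "b \<noteq> b'"
            unfolding popular_sumset_2_iff[OF fin(2)] by blast
          have "b \<noteq> b2" using *(1,5) by auto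
          moreover have "b' \<noteq> b2" using *(3,6) by auto
          ultimately show False using False * by blast
        qed
        show ?thesis
        proof (cases "a1 + b2 \<in> popular_sumset A 2 B")
          case True
          have "card (insert (a1 + b1) (?A + B)) \<le> card (A + B)"
            using x1 sub1 finS by (intro card_mono) auto
          moreover have "card (insert (a1 + b2) (popular_sumset ?A 2 B)) \<le> card (popular_sumset A 2 B)"
            using True p finP by (intro card_mono) auto
          ultimately show ?thesis
            using x1 x3 finite_subset[OF sub1 finS] finite_subset[OF p finP] by simp
        next
          case False
          have "unique_pair A B a1 b2" using False ab fin not_popular_iff_unique_pair by blast
          then have "a1 + b2 \<notin> ?A + B" by (rule new)
          moreover have "card (insert (a1 + b1) (insert (a1 + b2) (?A + B))) \<le> card (A + B)"
            using x1 x2 sub1 finS by (intro card_mono) auto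
          ultimately have "card (?A + B) + 2 \<le> card (A + B)"
            using x1 ne finite_subset[OF sub1 finS] by simp
          moreover have "card (popular_sumset ?A 2 B) \<le> card (popular_sumset A 2 B)"
            using p finP by (intro card_mono) auto
          ultimately show ?thesis by simp
        qed
      qed
      ultimately show ?thesis using cA by simp
    next
      case (star A2 B2)
      have V2: "card A + card B \<le> card (A2 + B2) + 2"
        using kemperman_scherk[of A2 B2 a1 b1] unique_pair_mono[OF u1 star(1,2)] fin star
        by (fastforce dest: finite_subset)
      have sub2: "A2 + B2 \<subseteq> A + B" using star by (intro set_plus_mono2)
      \<comment> \<open>An unpopular \<open>g\<close> in both sumsets would come from a pair unique
        for \<open>?A\<close> and \<open>B\<close> and also lying in \<open>A2\<close> and
        \<open>B2\<close>, which \<open>star\<close> excludes. Inclusion-exclusion then bounds the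
        two counts together by the sum of \<open>V1\<close> and \<open>V2\<close>.\<close>
      have "(?A + B) \<inter> (A2 + B2) \<subseteq> popular_sumset A 2 B"
      proof
        fix g assume g: "g \<in> (?A + B) \<inter> (A2 + B2)"
        then obtain a b where ga: "g = a + b" "a \<in> ?A" "b \<in> B" by (metis IntD1 set_plus_elim)
        from g obtain a' b' where ga': "g = a' + b'" "a' \<in> A2" "b' \<in> B2"
          by (metis IntD2 set_plus_elim)
        show "g \<in> popular_sumset A 2 B"
        proof (rule ccontr)
          assume "g \<notin> popular_sumset A 2 B"
          then have u: "unique_pair A B a b"
            using ga fin not_popular_iff_unique_pair[of B a A b] by simp
          then have "unique_pair ?A B a b" using ga by (intro unique_pair_mono[OF u]) auto
          then have "a \<notin> A2 \<or> b \<notin> B2" by (rule star(6))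
          moreover have "a' = a \<and> b' = b"
            using u ga(1) ga' star(1,2) unfolding unique_pair_def by auto
          ultimately show False using ga' by auto
        qed
      qed
      then have "card ((?A + B) \<inter> (A2 + B2)) \<le> card (popular_sumset A 2 B)"
        using finP by (intro card_mono)
      moreover have "card ((?A + B) \<union> (A2 + B2)) \<le> card (A + B)"
        by (intro card_mono finS Un_least sub1 sub2)
      moreover have "card (?A + B) + card (A2 + B2) =
          card ((?A + B) \<union> (A2 + B2)) + card ((?A + B) \<inter> (A2 + B2))"
        by (intro card_Un_Int finite_subset[OF sub1 finS] finite_subset[OF sub2 finS])
      ultimately show ?thesis using V1 V2 by linarith
    qed
  qed
qed

subsection \<open>Kneser's theorem\<close>

lemma mem_stabilizer_iff:
  assumes "finite X"
  shows "h \<in> stabilizer X \<longleftrightarrow> (\<forall>x\<in>X. h + x \<in> X)"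
proof
  assume "h \<in> stabilizer X"
  then have "h +o X = X" by (simp add: stabilizer_def)
  then show "\<forall>x\<in>X. h + x \<in> X" by (metis set_plus_intro2)
next
  assume "\<forall>x\<in>X. h + x \<in> X"
  then have "(+) h ` X \<subseteq> X" by auto
  then have "(+) h ` X = X" using assms by (intro card_subset_eq) (auto simp: card_image)
  moreover have "h +o X = (+) h ` X" by (auto simp: elt_set_plus_def)
  ultimately show "h \<in> stabilizer X" by (simp add: stabilizer_def)
qed

lemma stabilizer_diff: "x \<in> stabilizer X \<Longrightarrow> y \<in> stabilizer X \<Longrightarrow> x - y \<in> stabilizer X"
  using stabilizer_subgroup(2)[of x X "- y"] stabilizer_subgroup(3)[of y X] by simp

lemma stabilizer_plus_mem: "h \<in> stabilizer X \<Longrightarrow> x \<in> X \<Longrightarrow> h + x \<in> X"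
  unfolding stabilizer_def by (metis mem_Collect_eq set_plus_intro2)

lemma stabilizer_plus_mem_iff: "h \<in> stabilizer X \<Longrightarrow> h + x \<in> X \<longleftrightarrow> x \<in> X"
  using stabilizer_plus_mem[of h X x] stabilizer_plus_mem[of "- h" X "h + x"] stabilizer_subgroup(3)[of h X]
  by (auto simp: add.assoc[symmetric])

lemma finite_stabilizer:
  assumes "finite X" "X \<noteq> {}"
  shows "finite (stabilizer X)"
proof -
  obtain x where "x \<in> X" using assms by blast
  then have "(\<lambda>h. h + x) ` stabilizer X \<subseteq> X" using stabilizer_plus_mem by blast
  then have "finite ((\<lambda>h. h + x) ` stabilizer X)" using assms finite_subset by blast
  then show ?thesis by (rule finite_imageD) (simp add: inj_on_def)
qed

lemma plus_stabilizer_eq: "X + stabilizer X = X"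
proof
  show "X + stabilizer X \<subseteq> X"
    by (metis add.commute set_plus_elim stabilizer_plus_mem subsetI)
  show "X \<subseteq> X + stabilizer X"
    using set_plus_intro[of _ X 0 "stabilizer X"] stabilizer_subgroup(1)[of X] by fastforce
qed

section \<open>The union inequality and Kneser's theorem\<close>

lemma card_mult_le_card_sum_mult:
  fixes P Q K :: "'a::ab_group_add set"
  assumes "finite P" "finite Q" "finite K"
    and K: "\<And>p p' q q'. p \<in> P \<Longrightarrow> p' \<in> P \<Longrightarrow> q \<in> Q \<Longrightarrow> q' \<in> Q \<Longrightarrow> p + q = p' + q' \<Longrightarrow> p - p' \<in> K"
  shows "card P * card Q \<le> card (P + Q) * card K"
proof -
  \<comment> \<open>One representation is chosen for each sum. A pair \<open>(p, q)\<close> is then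
    determined by its sum and the offset of \<open>p\<close> from the chosen first summand, and this
    offset lies in \<open>K\<close>.\<close>
  define r where "r s = (SOME p. p \<in> P \<and> s - p \<in> Q)" for s
  have r: "r (p + q) \<in> P \<and> p + q - r (p + q) \<in> Q" if "p \<in> P" "q \<in> Q" for p q
    unfolding r_def by (rule someI[of _ p]) (use that in simp)
  define f where "f = (\<lambda>(p, q). (p + q, p - r (p + q)))"
  have "inj_on f (P \<times> Q)" by (auto simp: f_def inj_on_def)
  moreover have "f ` (P \<times> Q) \<subseteq> (P + Q) \<times> K"
  proof -
    have "p - r (p + q) \<in> K" if "p \<in> P" "q \<in> Q" for p q
      using K[of p "r (p + q)" q "p + q - r (p + q)"] r[OF that] that by simp
    then show ?thesis by (auto simp: f_def)
  qed
  ultimately have "card (P \<times> Q) \<le> card ((P + Q) \<times> K)"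
    using assms by (intro card_inj_on_le[where f = f]) (auto intro: finite_set_plus)
  then show ?thesis by (simp add: card_cartesian_product)
qed

text \<open>
  In the coset \<open>c + H + K\<close> of a point \<open>c\<close> of \<open>D\<close> outside \<open>C\<close>, the set \<open>D - C\<close> is the
  product \<open>P + Q\<close> and \<open>C - D\<close> contains the complementary product \<open>P' + Q'\<close>.
\<close>

lemma card_stabilizer_le_of_diff:
  fixes C D :: "'a::ab_group_add set"
  defines "H \<equiv> stabilizer C" and "K \<equiv> stabilizer D"
  assumes fin: "finite C" "finite D" and ne: "C \<noteq> {}" "D \<noteq> {}" and c: "c \<in> D" "c \<notin> C"
    and l1: "card (D - C) + card (H \<inter> K) < card H"
    and l2: "card (C - D) + card (H \<inter> K) < card K"
  shows "card K \<le> card (D - C)"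
proof (rule ccontr)
  assume neg: "\<not> card K \<le> card (D - C)"
  have finHK: "finite H" "finite K" using fin ne by (auto simp: H_def K_def finite_stabilizer)
  have sub0: "0 \<in> H" "0 \<in> K" by (simp_all add: H_def K_def stabilizer_subgroup)
  have C: "h + x \<in> C \<longleftrightarrow> x \<in> C" if "h \<in> H" for h x
    using that by (simp add: H_def stabilizer_plus_mem_iff)
  have D: "h + x \<in> D \<longleftrightarrow> x \<in> D" if "h \<in> K" for h x
    using that by (simp add: K_def stabilizer_plus_mem_iff)
  define P where "P = {k \<in> K. c + k \<notin> C}"
  define Q where "Q = {h \<in> H. c + h \<in> D}"
  define P' where "P' = K - P"
  define Q' where "Q' = H - Q"
  let ?h = "card (H \<inter> K)"
  have finPQ: "finite P" "finite Q" "finite P'" "finite Q'"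
    using finHK by (auto simp: P_def Q_def P'_def Q'_def)
  have cs: "card K = card P + card P'" "card H = card Q + card Q'"
    using finHK by (auto simp: P'_def Q'_def P_def Q_def card_Diff_subset card_mono)
  have hpos: "?h > 0" using finHK sub0 by (auto simp: card_gt_0_iff)
  \<comment> \<open>Equal sums satisfy \<open>p - p' = q' - q\<close>, an element of both
    \<open>K\<close> and \<open>H\<close>, so a sum has at most \<open>?h\<close>
    representations.\<close>
  have prod: "card R * card S \<le> card (R + S) * ?h" if "R \<subseteq> K" "S \<subseteq> H" for R S
  proof (rule card_mult_le_card_sum_mult)
    show "finite R" "finite S" "finite (H \<inter> K)" using that finHK finite_subset by auto
    fix p p' q q' assume *: "p \<in> R" "p' \<in> R" "q \<in> S" "q' \<in> S" "p + q = p' + q'"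
    have "p - p' \<in> K" using * that unfolding K_def by (intro stabilizer_diff) auto
    moreover have "p - p' = q' - q" using *(5) by (simp add: algebra_simps)
    moreover have "q' - q \<in> H" using * that unfolding H_def by (intro stabilizer_diff) auto
    ultimately show "p - p' \<in> H \<inter> K" by simp
  qed
  have "(+) c ` (P + Q) \<subseteq> D - C"
  proof
    fix x assume "x \<in> (+) c ` (P + Q)"
    then obtain p q where x: "p \<in> P" "q \<in> Q" "x = c + (p + q)" by (auto elim!: set_plus_elim)
    have eq: "x = q + (c + p)" "x = p + (c + q)" using x by (simp_all add: ac_simps)
    have "x \<notin> C" unfolding eq(1) using x C by (simp add: P_def Q_def)
    moreover have "x \<in> D" unfolding eq(2) using x D by (simp add: P_def Q_def)
    ultimately show "x \<in> D - C" by blast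
  qed
  then have "card ((+) c ` (P + Q)) \<le> card (D - C)" using fin by (intro card_mono) auto
  then have PQ: "card P * card Q \<le> card (D - C) * ?h"
    using prod[of P Q] by (simp add: card_image P_def Q_def) (meson le_trans mult_le_mono1)
  have "(+) c ` (P' + Q') \<subseteq> C - D"
  proof
    fix x assume "x \<in> (+) c ` (P' + Q')"
    then obtain p q where x: "p \<in> P'" "q \<in> Q'" "x = c + (p + q)" by (auto elim!: set_plus_elim)
    have eq: "x = q + (c + p)" "x = p + (c + q)" using x by (simp_all add: ac_simps)
    have "x \<in> C" unfolding eq(1) using x C by (simp add: P'_def Q'_def P_def Q_def)
    moreover have "x \<notin> D" unfolding eq(2) using x D by (simp add: P'_def Q'_def P_def Q_def)
    ultimately show "x \<in> C - D" by blast
  qed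
  then have "card ((+) c ` (P' + Q')) \<le> card (C - D)" using fin by (intro card_mono) auto
  then have PQ': "card P' * card Q' \<le> card (C - D) * ?h"
    using prod[of P' Q'] by (simp add: card_image P'_def Q'_def) (meson le_trans mult_le_mono1)
  have Q: "?h \<le> card Q"
    using c C D finPQ by (intro card_mono) (auto simp: Q_def add.commute[of c])
  \<comment> \<open>With \<open>P = K\<close> the product bound and \<open>card Q \<ge> ?h\<close>
    would give \<open>card K \<le> card (D - C)\<close>, the negated claim.\<close>
  have Pne: "P' \<noteq> {}"
  proof
    assume "P' = {}"
    then have "card K = card P" using cs by simp
    moreover have "card P * ?h \<le> card (D - C) * ?h"
      using PQ Q by (meson le_trans mult_le_mono2)
    ultimately show False using neg hpos by simp
  qed
  then obtain p where p: "p \<in> P'" by blast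
  have "card ((+) p ` (H \<inter> K)) \<le> card P'"
  proof (intro card_mono finPQ subsetI)
    fix x assume "x \<in> (+) p ` (H \<inter> K)"
    then obtain y where y: "x = p + y" "y \<in> H" "y \<in> K" by blast
    have "p + y \<in> K" using p y unfolding K_def P'_def by (intro stabilizer_subgroup(2)) auto
    moreover have eq: "c + (p + y) = y + (c + p)" by (simp add: ac_simps)
    have "c + (p + y) \<in> C" unfolding eq using p y C by (simp add: P'_def P_def)
    ultimately show "x \<in> P'" by (simp add: P'_def P_def y(1))
  qed
  then have P': "?h \<le> card P'" by (simp add: card_image)
  have P: "?h \<le> card P"
    using c C D finPQ by (intro card_mono) (auto simp: P_def add.commute[of c])
  \<comment> \<open>The product bounds together with \<open>l1\<close> and \<open>l2\<close> become
    \<open>(a - d) * b < (b' - d) * d\<close> and \<open>a' * (b' - d) < (a - d) * d\<close>. As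
    \<open>b \<ge> d\<close>, the first gives \<open>a < b'\<close>; as \<open>a' \<ge> d\<close>,
    the second gives \<open>b' < a\<close>. Integers are used so that the differences are not
    truncated.\<close>
  define a b a' b' d where "a = int (card P)" "b = int (card Q)" "a' = int (card P')"
    "b' = int (card Q')" "d = int ?h"
  note defs = this
  have i1: "a * b \<le> int (card (D - C)) * d" "a' * b' \<le> int (card (C - D)) * d"
    using PQ PQ' unfolding defs by (metis of_nat_mult of_nat_le_iff)+
  have "int (card (D - C)) * d \<le> (b + b' - d - 1) * d" "int (card (C - D)) * d \<le> (a + a' - d - 1) * d"
    using l1 l2 cs by (intro mult_right_mono; simp add: defs)+
  then have "a * b < (b + b' - d) * d" "a' * b' < (a + a' - d) * d"
    using i1 hpos by (auto simp: defs algebra_simps)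
  then have "(a - d) * b < (b' - d) * d" "a' * (b' - d) < (a - d) * d"
    by (simp_all add: algebra_simps)
  moreover have "(a - d) * d \<le> (a - d) * b"
    using P Q by (intro mult_left_mono) (auto simp: defs)
  ultimately have "(a - d) * d < (b' - d) * d" by linarith
  then have lt: "a - d < b' - d" using hpos by (simp add: defs)
  moreover have "0 \<le> a - d" using P by (simp add: defs)
  ultimately have "d * (b' - d) \<le> a' * (b' - d)"
    using P' by (intro mult_right_mono) (auto simp: defs)
  then have "(b' - d) * d < (a - d) * d"
    using \<open>a' * (b' - d) < (a - d) * d\<close> by (simp add: mult.commute)
  then show False using lt hpos by (simp add: defs)
qed

text \<open>If the bound failed, the preceding lemma would apply in both directions and give the
  cyclic chain \<open>card ?K \<le> card (D - C) < card ?H \<le> card (C - D) < card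
  ?K\<close>.\<close>

lemma kemperman_union:
  fixes C D :: "'a::ab_group_add set"
  assumes fin: "finite C" "finite D" and ne: "C \<noteq> {}" "D \<noteq> {}"
    and C: "n \<le> card C + card (stabilizer C)" and D: "n \<le> card D + card (stabilizer D)"
  shows "n \<le> card (C \<union> D) + card (stabilizer (C \<union> D))"
proof (rule ccontr)
  let ?H = "stabilizer C" and ?K = "stabilizer D" and ?S = "stabilizer (C \<union> D)"
  assume neg: "\<not> ?thesis"
  have "?H \<inter> ?K \<subseteq> ?S"
    using fin by (auto simp: mem_stabilizer_iff)
  moreover have "finite ?S" using fin ne by (intro finite_stabilizer) auto
  ultimately have le: "card (?H \<inter> ?K) \<le> card ?S" by (rule card_mono[rotated])
  have cu: "card (C \<union> D) = card C + card (D - C)" "card (C \<union> D) = card D + card (C - D)"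
    using fin card_Un_disjoint[of C "D - C"] card_Un_disjoint[of D "C - D"]
    by (auto simp: Un_commute)
  have l1: "card (D - C) + card (?H \<inter> ?K) < card ?H"
    using C neg le cu by linarith
  have l2: "card (C - D) + card (?H \<inter> ?K) < card ?K"
    using D neg le cu by linarith
  have "\<not> D \<subseteq> C" using C neg by (auto simp: Un_absorb2)
  then obtain d where "d \<in> D" "d \<notin> C" by blast
  then have "card ?K \<le> card (D - C)"
    using card_stabilizer_le_of_diff[OF fin ne _ _ l1 l2] by blast
  have "\<not> C \<subseteq> D" using D neg by (auto simp: Un_absorb1)
  then obtain c where "c \<in> C" "c \<notin> D" by blast
  then have "card ?H \<le> card (C - D)"
    using card_stabilizer_le_of_diff[OF fin(2,1) ne(2,1)] l1 l2 by (simp add: Int_commute)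
  then show False using \<open>card ?K \<le> card (D - C)\<close> l1 l2 by linarith
qed

text \<open>Dyson transforms that keep \<open>a\<close> and \<open>b\<close> shrink \<open>B\<close>
  until every translate of \<open>A\<close> by \<open>y - b\<close> with \<open>y \<in> B\<close>
  stays in \<open>A\<close>. Then \<open>C = b + A\<close> has at least \<open>card B\<close>
  stabilizing elements, namely the differences \<open>y - b\<close>.\<close>

lemma kneser_component:
  assumes "finite A" "finite B" "a \<in> A" "b \<in> B"
  shows "\<exists>C\<subseteq>A + B. a + b \<in> C \<and> card A + card B \<le> card C + card (stabilizer C)"
  using assms
proof (induction "card B" arbitrary: A B rule: less_induct)
  case less
  note fin = less.prems(1,2) and ab = less.prems(3,4)
  show ?case
  proof (cases "\<forall>x\<in>A. \<forall>y\<in>B. x - b + y \<in> A")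
    case True
    define C where "C = (+) b ` A"
    have "finite C" using fin by (simp add: C_def)
    have "y - b \<in> stabilizer C" if "y \<in> B" for y
    proof -
      have "y - b + (b + x) \<in> C" if "x \<in> A" for x
      proof -
        have "y - b + (b + x) = b + (x - b + y)" by (simp add: algebra_simps)
        then show ?thesis using True that \<open>y \<in> B\<close> unfolding C_def by (metis image_eqI)
      qed
      then show ?thesis using \<open>finite C\<close> by (auto simp: mem_stabilizer_iff C_def)
    qed
    then have "(\<lambda>y. y - b) ` B \<subseteq> stabilizer C" by blast
    moreover have "C \<noteq> {}" using ab by (auto simp: C_def)
    ultimately have "card ((\<lambda>y. y - b) ` B) \<le> card (stabilizer C)"
      using \<open>finite C\<close> by (intro card_mono finite_stabilizer)
    then have "card B \<le> card (stabilizer C)" by (simp add: card_image inj_on_def)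
    moreover have "card C = card A" by (simp add: C_def card_image)
    moreover have "C \<subseteq> A + B" using ab by (auto simp: C_def add.commute[of b])
    moreover have "a + b \<in> C" using ab by (auto simp: C_def add.commute[of b])
    ultimately show ?thesis by (intro exI[of _ C]) auto
  next
    case False
    then obtain x y where xy: "x \<in> A" "y \<in> B" "x - b + y \<notin> A" by blast
    \<comment> \<open>This shift keeps \<open>b\<close>, since \<open>e + b = x \<in> A\<close>, and
      discards \<open>y\<close>, since \<open>e + y \<notin> A\<close>.\<close>
    define e where "e = x - b"
    let ?U = "dyson_union e A B" and ?I = "dyson_inter e A B"
    have "?I \<subset> B" using xy by (auto simp: dyson_inter_def e_def)
    then have "card ?I < card B" by (simp add: fin psubset_card_mono)
    moreover have "a \<in> ?U" "b \<in> ?I"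
      using ab xy by (auto simp: dyson_inter_def dyson_union_def e_def)
    ultimately obtain C where "C \<subseteq> ?U + ?I" "a + b \<in> C"
      "card ?U + card ?I \<le> card C + card (stabilizer C)"
      using less.hyps[OF _ finite_dyson[OF fin, of e]] by auto
    then show ?thesis
      using dyson_sumset_subset[of e A B] card_dyson[OF fin, of e] by (intro exI[of _ C]) auto
  qed
qed

text \<open>The components through the points of \<open>A + B\<close> are merged one at a time by
  \<open>kemperman_union\<close>; once all points are covered the union is \<open>A + B\<close>
  itself.\<close>

lemma kneser_weak:
  assumes fin: "finite A" "finite B" and ne: "A \<noteq> {}" "B \<noteq> {}"
  shows "card A + card B \<le> card (A + B) + card (stabilizer (A + B))"
proof -
  have finS: "finite (A + B)" using fin by (rule finite_set_plus)
  have component: "\<exists>C\<subseteq>A + B. x \<in> C \<and> card A + card B \<le> card C + card (stabilizer C)"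
    if "x \<in> A + B" for x
    using that kneser_component[OF fin] by (metis set_plus_elim)
  have *: "\<exists>D. S \<subseteq> D \<and> D \<subseteq> A + B \<and> card A + card B \<le> card D + card (stabilizer D)"
    if "finite S" "S \<noteq> {}" "S \<subseteq> A + B" for S
    using that
  proof (induction rule: finite_ne_induct)
    case (singleton x)
    then show ?case using component[of x] by auto
  next
    case (insert x S)
    then obtain D where D: "S \<subseteq> D" "D \<subseteq> A + B" "card A + card B \<le> card D + card (stabilizer D)"
      by auto
    obtain C where C: "C \<subseteq> A + B" "x \<in> C" "card A + card B \<le> card C + card (stabilizer C)"
      using insert.prems component[of x] by auto
    have "card A + card B \<le> card (C \<union> D) + card (stabilizer (C \<union> D))"
      using C D insert.hyps finite_subset[OF _ finS] by (intro kemperman_union) auto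
    then show ?case using C D by (intro exI[of _ "C \<union> D"]) auto
  qed
  have "A + B \<noteq> {}" using ne set_plus_intro by blast
  then obtain D where "A + B \<subseteq> D" "D \<subseteq> A + B" "card A + card B \<le> card D + card (stabilizer D)"
    using *[of "A + B"] finS by auto
  moreover from this have "D = A + B" by blast
  ultimately show ?thesis by simp
qed

text \<open>Enlarging both summands by \<open>H\<close> does not change the sumset, so the weak form
  applied to \<open>A + H\<close> and \<open>B + H\<close> suffices.\<close>

theorem kneser:
  fixes A B :: "'a::ab_group_add set"
  defines "H \<equiv> stabilizer (A + B)"
  assumes fin: "finite A" "finite B" and ne: "A \<noteq> {}" "B \<noteq> {}"
  shows "card (A + H) + card (B + H) \<le> card (A + B) + card H"
proof -
  have "A + B \<noteq> {}" using ne set_plus_intro by blast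
  then have "finite H" using fin by (simp add: H_def finite_stabilizer finite_set_plus)
  have "(A + H) + (B + H) = (A + B + H) + H" by (simp add: ac_simps)
  also have "\<dots> = A + B" by (simp add: H_def plus_stabilizer_eq)
  finally have eq: "(A + H) + (B + H) = A + B" .
  have "H \<noteq> {}" using stabilizer_subgroup(1) by (auto simp: H_def)
  then have "A + H \<noteq> {}" "B + H \<noteq> {}" using ne by (auto dest: set_plus_intro simp: set_plus_def)
  then show ?thesis
    using kneser_weak[of "A + H" "B + H"] fin \<open>finite H\<close> by (simp add: eq H_def[symmetric] finite_set_plus)
qed

lemma card_le_card_plus_stabilizer:
  assumes "finite A" "finite (stabilizer X)"
  shows "card A \<le> card (A + stabilizer X)"
proof (rule card_mono)
  show "finite (A + stabilizer X)" using assms by (rule finite_set_plus)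
  show "A \<subseteq> A + stabilizer X"
    using set_plus_intro[of _ A 0 "stabilizer X"] stabilizer_subgroup(1)[of X] by fastforce
qed

subsection \<open>Unique sums with a common summand\<close>

lemma popular_sumset_2_eq_sumset:
  assumes "finite B" "\<And>a b. \<not> unique_pair A B a b"
  shows "popular_sumset A 2 B = A + B"
proof
  show "popular_sumset A 2 B \<subseteq> A + B" using assms(1) by (rule popular_sumset_2_subset)
  show "A + B \<subseteq> popular_sumset A 2 B"
  proof
    fix g assume "g \<in> A + B"
    then obtain a b where "a \<in> A" "b \<in> B" "g = a + b" by (rule set_plus_elim)
    then show "g \<in> popular_sumset A 2 B"
      using not_popular_iff_unique_pair[OF assms(1), of a A b] assms(2) by blast
  qed
qed

text \<open>Covers \<open>l = 1\<close>. A popular sum has a representation avoiding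
  \<open>a\<close>, and a sum of \<open>A' + B\<close> cannot be unique because unique pairs use
  \<open>a\<close>; hence deleting \<open>a\<close> leaves exactly the popular sums.\<close>

lemma unique_pairs_star:
  fixes A B :: "'a::ab_group_add set"
  assumes fin: "finite A" "finite B" and A: "card A \<ge> 2"
    and few: "card (A + B) + card (popular_sumset A 2 B) + 4 < 2 * card A + 2 * card B"
    and u: "unique_pair A B a b" and star: "\<forall>x y. unique_pair A B x y \<longrightarrow> x = a"
  defines "A' \<equiv> A - {a}" and "H \<equiv> stabilizer (popular_sumset A 2 B)"
  shows "popular_sumset A' 2 B = A' + B" "A' + B = popular_sumset A 2 B" "finite H" "card H \<ge> 2"
    "card (A' + H) + card (B + H) + card A' + card B \<le> card (A + B) + card (popular_sumset A 2 B) + card H"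
proof -
  have ab: "a \<in> A" "b \<in> B" using u by (auto simp: unique_pair_def)
  have cA: "card A = card A' + 1" unfolding A'_def using fin ab by (metis Suc_eq_plus1 card_Suc_Diff1)
  have finA': "finite A'" using fin by (simp add: A'_def)
  have ne: "A' \<noteq> {}" "B \<noteq> {}" using cA A ab by auto
  have finS: "finite (A + B)" using fin by (rule finite_set_plus)
  show eq: "A' + B = popular_sumset A 2 B"
  proof
    show "A' + B \<subseteq> popular_sumset A 2 B"
    proof
      fix g assume "g \<in> A' + B"
      then obtain x y where *: "x \<in> A'" "y \<in> B" "g = x + y" by (rule set_plus_elim)
      then show "g \<in> popular_sumset A 2 B"
        using not_popular_iff_unique_pair[OF fin(2), of x A y] star by (auto simp: A'_def)
    qed
    show "popular_sumset A 2 B \<subseteq> A' + B"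
    proof
      fix g assume "g \<in> popular_sumset A 2 B"
      then obtain x y x' y' where *: "x \<in> A" "y \<in> B" "x' \<in> A" "y' \<in> B" "g = x + y" "g = x' + y'" "y \<noteq> y'"
        unfolding popular_sumset_2_iff[OF fin(2)] by blast
      have "x \<noteq> a \<or> x' \<noteq> a" using * by auto
      then show "g \<in> A' + B" using * by (metis A'_def Diff_iff set_plus_intro singletonD)
    qed
  qed
  \<comment> \<open>The Kemperman-Scherk bound for \<open>A\<close> and \<open>B\<close> makes the
    sumset large, so by \<open>few\<close> the popular sums are too few for \<open>A'\<close> and
    \<open>B\<close> to have a unique pair of their own.\<close>
  have "card (A' + B) + 1 < card A' + card B"
    using kemperman_scherk[OF fin u] few cA unfolding eq by linarith
  then have nu: "\<not> unique_pair A' B x y" for x y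
    using kemperman_scherk[OF finA' fin(2), of x y] by linarith
  show "popular_sumset A' 2 B = A' + B" using fin(2) nu by (rule popular_sumset_2_eq_sumset)
  have H: "H = stabilizer (A' + B)" by (simp add: H_def eq)
  have "A' + B \<noteq> {}" using ne set_plus_intro by blast
  then show finH: "finite H" using finA' fin by (simp add: H finite_stabilizer finite_set_plus)
  have kn: "card (A' + H) + card (B + H) \<le> card (A' + B) + card H"
    using kneser[OF finA' fin(2) ne] by (simp add: H)
  have ge: "card A' \<le> card (A' + H)" "card B \<le> card (B + H)"
    using finA' fin finH by (simp_all add: H card_le_card_plus_stabilizer)
  show "card H \<ge> 2" using kn ge \<open>card (A' + B) + 1 < card A' + card B\<close> by linarith
  have new: "a + b \<notin> A' + B"
    using u not_popular_iff_unique_pair[OF fin(2) ab] by (simp add: eq)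
  \<comment> \<open>\<open>F\<close> marks the part of the coset \<open>b + H\<close> that lies in
    \<open>B\<close>. Its translates \<open>a + b + F\<close> are sums outside
    \<open>A' + B\<close>, as the whole coset of \<open>a + b\<close> misses that set, while
    \<open>b + (H - F)\<close> consists of holes counted by
    \<open>card (B + H) - card B\<close>.\<close>
  define F where "F = {h \<in> H. b + h \<in> B}"
  have finF: "finite F" using finH by (simp add: F_def)
  have "(A' + B) \<inter> (+) (a + b) ` F = {}"
  proof -
    have "a + b + h \<notin> A' + B" if "h \<in> H" for h
      using that new stabilizer_plus_mem_iff[of h "A' + B" "a + b"] by (simp add: H add.commute)
    then show ?thesis by (auto simp: F_def)
  qed
  then have "card ((A' + B) \<union> (+) (a + b) ` F) = card (A' + B) + card F"
    using finF finA' fin by (subst card_Un_disjoint) (auto simp: card_image intro: finite_set_plus)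
  moreover have "(A' + B) \<union> (+) (a + b) ` F \<subseteq> A + B"
  proof (rule Un_least)
    show "A' + B \<subseteq> A + B" by (intro set_plus_mono2) (auto simp: A'_def)
    show "(+) (a + b) ` F \<subseteq> A + B"
      using ab by (auto simp: F_def add.assoc)
  qed
  ultimately have N1: "card (A' + B) + card F \<le> card (A + B)"
    using card_mono[OF finS] by metis
  have "card (B \<union> (+) b ` (H - F)) = card B + card (H - F)"
    using finH fin by (subst card_Un_disjoint) (auto simp: card_image F_def)
  moreover have "B \<union> (+) b ` (H - F) \<subseteq> B + H"
    using ab set_plus_intro[of _ B 0 H] stabilizer_subgroup(1)[of "A' + B"]
    by (fastforce simp: H intro: set_plus_intro)
  ultimately have "card B + card (H - F) \<le> card (B + H)"
    using card_mono[OF finite_set_plus[OF fin(2) finH]] by metis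
  moreover have "card (H - F) + card F = card H"
    using finH by (simp add: F_def card_Diff_subset card_mono)
  \<comment> \<open>Kneser's bound enters twice, for \<open>A' + B\<close> inside
    \<open>A + B\<close> and for the popular sums; one of the two terms \<open>card (A' + H)\<close>
    is then weakened to \<open>card A'\<close>.\<close>
  ultimately show "card (A' + H) + card (B + H) + card A' + card B
      \<le> card (A + B) + card (popular_sumset A 2 B) + card H"
    using N1 kn ge unfolding eq[symmetric] by linarith
qed

section \<open>Assembly of the cases by the configuration of unique pairs\<close>

theorem theorem1p2:
  fixes A B :: "'a::ab_group_add set"
  assumes "finite A" and "finite B" and "A \<noteq> {}" and "B \<noteq> {}"
    and "card A \<ge> 2" and "card B \<ge> 2"
  shows
    "int (card (popular_sumset A 1 B)) + int (card (popular_sumset A 2 B))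
       \<ge> 2 * int (card A) + 2 * int (card B) - 4
     \<or>
     (\<exists>A' B'. A' \<subseteq> A \<and> B' \<subseteq> B \<and>
       (let l = int (card (A - A')) + int (card (B - B'));
            H = stabilizer (popular_sumset A 2 B);
            \<rho> = int (card (A' + H)) - int (card A') + int (card (B' + H)) - int (card B')
        in H \<noteq> {0} \<and>
           l \<le> 1 \<and>
           popular_sumset A' 2 B' = A' + B' \<and>
           A' + B' = popular_sumset A 2 B \<and>
           int (card (popular_sumset A 1 B)) + int (card (popular_sumset A 2 B))
             \<ge> 2 * int (card A) + 2 * int (card B) - (2 - l) * (int (card H) - \<rho>) - 2 * l \<and>
           2 * int (card A) + 2 * int (card B) - (2 - l) * (int (card H) - \<rho>) - 2 * l
             \<ge> 2 * int (card A) + 2 * int (card B) - 2 * int (card H)))"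
proof (cases "2 * card A + 2 * card B \<le> card (A + B) + card (popular_sumset A 2 B) + 4")
  case True
  then show ?thesis using assms(1) unfolding popular_sumset_1[OF assms(1)] by linarith
next
  case False
  note fin = assms(1,2)
  have few: "card (A + B) + card (popular_sumset A 2 B) + 4 < 2 * card A + 2 * card B"
    using False by simp
  have ng0: "H \<noteq> {0}" if "card H \<ge> 2" for H :: "'a set" using that by auto
  have "\<not> (unique_pair A B a b \<and> unique_pair A B a' b' \<and> a \<noteq> a' \<and> b \<noteq> b')" for a b a' b'
    using sum_popular_lower_bound[OF fin, of a b a' b'] few by linarith
  \<comment> \<open>Pairs that pairwise agree in a summand all share one: given a pair
    \<open>(a, b)\<close>, pairs \<open>(a, y)\<close> and \<open>(x, b)\<close> with
    \<open>x \<noteq> a\<close> and \<open>y \<noteq> b\<close> would be disjoint.\<close>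
  then have "(\<forall>a b. \<not> unique_pair A B a b)
      \<or> (\<exists>a b. unique_pair A B a b \<and> (\<forall>x y. unique_pair A B x y \<longrightarrow> x = a))
      \<or> (\<exists>a b. unique_pair A B a b \<and> (\<forall>x y. unique_pair A B x y \<longrightarrow> y = b))"
    by metis
  then consider "\<And>a b. \<not> unique_pair A B a b"
    | a b where "unique_pair A B a b" "\<forall>x y. unique_pair A B x y \<longrightarrow> x = a"
    | a b where "unique_pair A B a b" "\<forall>x y. unique_pair A B x y \<longrightarrow> y = b"
    by blast
  then show ?thesis
  proof cases
    case 1
    have eq: "popular_sumset A 2 B = A + B" using fin(2) 1 by (rule popular_sumset_2_eq_sumset)
    let ?H = "stabilizer (A + B)"
    have "A + B \<noteq> {}" using assms set_plus_intro by blast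
    then have finH: "finite ?H" using fin by (simp add: finite_stabilizer finite_set_plus)
    have kn: "card (A + ?H) + card (B + ?H) \<le> card (A + B) + card ?H"
      using assms by (intro kneser)
    have ge: "card A \<le> card (A + ?H)" "card B \<le> card (B + ?H)"
      using fin finH by (simp_all add: card_le_card_plus_stabilizer)
    have "card ?H \<ge> 2" using few kn ge unfolding eq by linarith
    \<comment> \<open>Nothing is deleted, so \<open>l = 0\<close>, and the bound is twice
      \<open>kn\<close>.\<close>
    then show ?thesis
      using ng0[of ?H] kn ge
      by (intro disjI2 exI[of _ A] exI[of _ B]) (simp add: popular_sumset_1[OF fin(1), simplified] eq Let_def)
  next
    case (2 a b)
    note * = unique_pairs_star[OF fin assms(5) few 2]
    let ?A = "A - {a}" and ?H = "stabilizer (popular_sumset A 2 B)"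
    have aA: "a \<in> A" using 2(1) by (simp add: unique_pair_def)
    then have cA: "card A = card ?A + 1" using fin by (metis Suc_eq_plus1 card_Suc_Diff1)
    have "A - ?A = {a}" using aA by auto
    moreover have ge: "card ?A \<le> card (?A + ?H)" "card B \<le> card (B + ?H)"
      using fin *(3) by (simp_all add: card_le_card_plus_stabilizer)
    \<comment> \<open>Here \<open>l = 1\<close>. The last inequality of the conclusion amounts to
      \<open>card ?H - \<rho> + 2 \<le> 2 * card ?H\<close>, which follows from
      \<open>\<rho> \<ge> 0\<close> by \<open>ge\<close> and \<open>card ?H \<ge> 2\<close>.\<close>
    ultimately show ?thesis
      using ng0[OF *(4)] *(1,2,4,5) cA unfolding popular_sumset_1[OF fin(1)]
      by (intro disjI2 exI[of _ ?A] exI[of _ B]) (simp add: Let_def)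
  next
    case (3 a b)
    \<comment> \<open>The preceding case with the two sets exchanged; \<open>swap\<close> translates
      the result back.\<close>
    have few': "card (B + A) + card (popular_sumset B 2 A) + 4 < 2 * card B + 2 * card A"
      using few by (simp add: add.commute popular_sumset_commute[of B])
    have u: "unique_pair B A b a" "\<forall>x y. unique_pair B A x y \<longrightarrow> x = b"
      using 3 unique_pair_commute by blast+
    note * = unique_pairs_star[OF fin(2,1) assms(6) few' u]
    let ?B = "B - {b}" and ?H = "stabilizer (popular_sumset A 2 B)"
    have swap: "popular_sumset B 2 A = popular_sumset A 2 B" "popular_sumset ?B 2 A = popular_sumset A 2 ?B"
      "B + A = A + B" "?B + A = A + ?B"
      by (simp_all only: add.commute popular_sumset_commute[of _ _ A])
    note ** = *[unfolded swap]
    have bB: "b \<in> B" using 3(1) by (simp add: unique_pair_def)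
    then have cB: "card B = card ?B + 1" using fin by (metis Suc_eq_plus1 card_Suc_Diff1)
    have "B - ?B = {b}" using bB by auto
    moreover have ge: "card ?B \<le> card (?B + ?H)" "card A \<le> card (A + ?H)"
      using fin **(3) by (simp_all add: card_le_card_plus_stabilizer)
    ultimately show ?thesis
      using ng0[OF **(4)] **(1,2,4,5) cB unfolding popular_sumset_1[OF fin(1)]
      by (intro disjI2 exI[of _ A] exI[of _ ?B]) (simp add: Let_def)
  qed
qed

end
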